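(* Let $m\ge1$, let $I$ be a finite set, and for each $i\in I$ let $G^i$ be a GEV choice probability generating function on $\mathbb{R}^m_+$. Given any $i\in I$ and any $S\subset[m]$, the function $\mathbf{v}^i\mapsto G^i(\mathbf{Y}(\mathbf{v}^i)\,|\,S)$ is strictly convex in $\mathbf{v}^i\in\mathbb{R}^m$.
   Context: $[m]=\{1,\dots,m\}$. GEV choice probability generating function (CPGF): a continuous function $G:\mathbb{R}^m_+\to\mathbb{R}$ with continuous mixed partial derivatives at points with strictly positive entries, such that (i) $G(\mathbf{Y})\ge 0$ for all $\mathbf{Y}\in\mathbb{R}^m_+$; (ii) $G(\lambda\mathbf{Y})=\lambda G(\mathbf{Y})$ for every scalar $\lambda>0$; (iii) $G(\mathbf{Y})\to\infty$ if $Y_j\to\infty$, for any $j\in[m]$; (iv) for distinct $j_1,\dots,j_k\in[m]$, the mixed partial derivative $\partial G_{j_1\dots j_k}(\mathbf{Y})$ with respect to $Y_{j_1},\dots,Y_{j_k}$ is $>0$ if $k$ is odd and $\le 0$ if $k$ is even. For $\mathbf{v}\in\mathbb{R}^m$, $\mathbf{Y}(\mathbf{v})\in\mathbb{R}^m$ has entries $Y(\mathbf{v})_j=e^{v_j}$. For $S\subset[m]$, $G(\mathbf{Y}|S)=G(\overline{\mathbf{Y}})$, where $\overline{Y}_j=Y_j$ if $j\in S$ and $\overline{Y}_j=0$ otherwise. As a function of the variables $(Y_j)_{j\in S}$, $G(\cdot|S)$ is understood to satisfy the same properties.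
   Formalization: For S a proper subset of [m] the function is constant in the entries v_j with j not in S, so it is not strictly convex on R^m; strict convexity is proved in the variables v_j, j in S, that is, for points differing in some coordinate of S (for S = [m], on all of R^m). *)

theory Defs
  imports "HOL-Analysis.Analysis"
begin

text \<open>
  The index set \<open>[m]\<close> is a finite type \<open>'m\<close>. A function of the variables \<open>(Y\<^sub>j)\<close> with \<open>j \<in> S\<close> is
  represented by a function on \<open>real ^ 'm\<close>, of which only the values on the coordinate
  subspace where \<open>Y\<^sub>j = 0\<close> for all \<open>j \<notin> S\<close> matter.
\<close>

definition orthant :: "'m::finite set \<Rightarrow> (real ^ 'm) set" where
  "orthant S = {Y. (\<forall>j\<in>S. 0 \<le> Y $ j) \<and> (\<forall>j. j \<notin> S \<longrightarrow> Y $ j = 0)}"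

definition pos_orthant :: "'m::finite set \<Rightarrow> (real ^ 'm) set" where
  "pos_orthant S = {Y. (\<forall>j\<in>S. 0 < Y $ j) \<and> (\<forall>j. j \<notin> S \<longrightarrow> Y $ j = 0)}"

definition partial_deriv :: "'m::finite \<Rightarrow> (real ^ 'm \<Rightarrow> real) \<Rightarrow> real ^ 'm \<Rightarrow> real" where
  "partial_deriv j f Y = deriv (\<lambda>t. f (Y + t *\<^sub>R axis j 1)) 0"

definition has_partial_deriv_at :: "'m::finite \<Rightarrow> (real ^ 'm \<Rightarrow> real) \<Rightarrow> real ^ 'm \<Rightarrow> bool" where
  "has_partial_deriv_at j f Y \<longleftrightarrow> (\<lambda>t. f (Y + t *\<^sub>R axis j 1)) field_differentiable (at 0)"

fun mixed_partial :: "'m::finite list \<Rightarrow> (real ^ 'm \<Rightarrow> real) \<Rightarrow> real ^ 'm \<Rightarrow> real" where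
  "mixed_partial [] f = f"
| "mixed_partial (j # js) f = partial_deriv j (mixed_partial js f)"

text \<open>
  ``Mixed'' means with respect to pairwise distinct variables; all orders \<open>k \<ge> 1\<close>, first-order
  partials included, and all orders of differentiation are covered. Repeated differentiation in
  the same variable is not assumed possible.
\<close>

definition has_continuous_mixed_partials ::
    "'m::finite set \<Rightarrow> (real ^ 'm \<Rightarrow> real) \<Rightarrow> bool" where
  "has_continuous_mixed_partials S G \<longleftrightarrow>
     (\<forall>j js. distinct (j # js) \<and> set (j # js) \<subseteq> S \<longrightarrow>
        (\<forall>Y\<in>pos_orthant S. has_partial_deriv_at j (mixed_partial js G) Y) \<and>
        continuous_on (pos_orthant S) (mixed_partial (j # js) G))"

text \<open>
  \<open>gev_cpgf_on S G\<close>: as a function of the variables \<open>(Y\<^sub>j)\<close> with \<open>j \<in> S\<close>, \<open>G\<close> is a GEV choice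
  probability generating function. In the limit condition \<open>Y\<^sub>j\<close> tends to infinity while the
  other variables are held fixed at arbitrary nonnegative values.
\<close>

definition gev_cpgf_on :: "'m::finite set \<Rightarrow> (real ^ 'm \<Rightarrow> real) \<Rightarrow> bool" where
  "gev_cpgf_on S G \<longleftrightarrow>
     continuous_on (orthant S) G \<and>
     has_continuous_mixed_partials S G \<and>
     (\<forall>Y\<in>orthant S. 0 \<le> G Y) \<and>
     (\<forall>Y\<in>orthant S. \<forall>c>0. G (c *\<^sub>R Y) = c * G Y) \<and>
     (\<forall>Y\<in>orthant S. \<forall>j\<in>S.
        filterlim (\<lambda>t. G (\<chi> k. if k = j then t else Y $ k)) at_top at_top) \<and>
     (\<forall>js. js \<noteq> [] \<and> distinct js \<and> set js \<subseteq> S \<longrightarrow>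
        (\<forall>Y\<in>pos_orthant S.
           (odd (length js) \<longrightarrow> 0 < mixed_partial js G Y) \<and>
           (even (length js) \<longrightarrow> mixed_partial js G Y \<le> 0)))"

definition gev_cpgf :: "(real ^ 'm::finite \<Rightarrow> real) \<Rightarrow> bool" where
  "gev_cpgf G \<longleftrightarrow> gev_cpgf_on UNIV G"

definition exp_vec :: "real ^ 'm::finite \<Rightarrow> real ^ 'm" where
  "exp_vec v = (\<chi> j. exp (v $ j))"

definition restricted :: "(real ^ 'm::finite \<Rightarrow> real) \<Rightarrow> 'm set \<Rightarrow> real ^ 'm \<Rightarrow> real" where
  "restricted G S Y = G (\<chi> j. if j \<in> S then Y $ j else 0)"

text \<open>
  Strict convexity in the variables \<open>(v\<^sub>j)\<close> with \<open>j \<in> S\<close>, of a function on \<open>real ^ 'm\<close>. The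
  function \<open>\<lambda>v. restricted G S (exp_vec v)\<close> does not depend on the other variables, so the strict
  inequality can only be required of points that differ in some coordinate in \<open>S\<close>. For
  \<open>S = UNIV\<close> this is ordinary strict convexity on \<open>real ^ 'm\<close>.
\<close>

definition strictly_convex_in :: "'m::finite set \<Rightarrow> (real ^ 'm \<Rightarrow> real) \<Rightarrow> bool" where
  "strictly_convex_in S f \<longleftrightarrow>
     (\<forall>v w t. (\<exists>j\<in>S. v $ j \<noteq> w $ j) \<and> 0 < t \<and> t < 1 \<longrightarrow>
        f ((1 - t) *\<^sub>R v + t *\<^sub>R w) < (1 - t) * f v + t * f w)"

lemma strictly_convex_in_UNIV:
  "strictly_convex_in UNIV f \<longleftrightarrow>
     (\<forall>v w t. v \<noteq> w \<and> 0 < t \<and> t < 1 \<longrightarrow>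
        f ((1 - t) *\<^sub>R v + t *\<^sub>R w) < (1 - t) * f v + t * f w)"
  by (simp add: strictly_convex_in_def vec_eq_iff)

lemma restricted_UNIV: "restricted G UNIV = G"
  by (simp add: restricted_def fun_eq_iff)

end

theory Submission
  imports Defs
begin

text \<open>
  Put \<open>H = restricted G S\<close> and write \<open>H\<^sub>j\<close> for its partial derivatives. The heart of the matter is
  that \<open>H\<close> itself is convex on the positive orthant (\<open>gev_convex\<close>): homogeneity together with
  nonpositive mixed second derivatives forces convexity. Strict convexity in \<open>v\<close> then comes from the
  exponential alone. Each coordinate of \<open>exp_vec\<close> is strictly convex, and \<open>H\<close> is strictly
  increasing because \<open>H\<^sub>j > 0\<close>, so
  \<open>H (exp ((1 - t) v + t w)) < H ((1 - t) exp v + t exp w) \<le> (1 - t) H (exp v) + t H (exp w)\<close>.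

  If \<open>H\<close> had all second derivatives, convexity could be read off the Hessian. Differentiating
  \<open>H(cY) = c H(Y)\<close> shows that \<open>Y\<close> is in its kernel, so its quadratic form at \<open>z\<^sub>j = d\<^sub>j Y\<^sub>j\<close> is
  \<open>1/2 \<Sum> (- H\<^sub>j\<^sub>k) Y\<^sub>j Y\<^sub>k (d\<^sub>j - d\<^sub>k)\<^sup>2 \<ge> 0\<close>. With mixed derivatives in
  distinct variables alone, the argument is carried by the first derivatives. Each \<open>H\<^sub>j\<close> is
  homogeneous of degree 0 and nonincreasing in \<open>Y\<^sub>k\<close> for \<open>k \<noteq> j\<close>; hence it is a nonincreasing function of
  the ratios \<open>Y\<^sub>k / Y\<^sub>j\<close> (\<open>gev_partial_le_if_ratios_le\<close>).

  By homogeneity, convexity is the tangent inequality \<open>\<Sum> y\<^sub>j H\<^sub>j(x) \<le> H(y)\<close> (\<open>gev_tangent_le\<close>)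
  combined with Euler's relation. To prove it, join \<open>0\<close> to \<open>y\<close> by the path
  \<open>z(s) = min (s x) y\<close>, taken coordinatewise. The coordinates that still move at time \<open>s\<close> satisfy
  \<open>z\<^sub>j = s x\<^sub>j\<close>, while \<open>z\<^sub>k \<le> s x\<^sub>k\<close> for every \<open>k\<close>; so the ratios \<open>z\<^sub>k / z\<^sub>j\<close> are at most
  \<open>x\<^sub>k / x\<^sub>j\<close>, and \<open>H\<^sub>j(z(s)) \<ge> H\<^sub>j(x)\<close> for each moving \<open>j\<close>. Integrating along the path
  gives the claim. In place of the integral, the path is cut at the times \<open>e (1 + e)\<^sup>n\<close>, which makes
  the relative error the same on every piece, and \<open>e\<close> tends to \<open>0\<close>.
\<close>

section \<open>Differences as sums of partial derivatives\<close>

lemma pos_orthant_between: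
  assumes "x \<in> pos_orthant S" "y \<in> pos_orthant S"
    and "\<And>k. min (x $ k) (y $ k) \<le> z $ k \<and> z $ k \<le> max (x $ k) (y $ k)"
  shows "z \<in> pos_orthant S"
  unfolding pos_orthant_def
proof (intro CollectI conjI ballI allI impI)
  fix k assume "k \<in> S"
  then show "0 < z $ k" using assms(1,2) assms(3)[of k] by (auto simp: pos_orthant_def min_def split: if_splits)
next
  fix k assume "k \<notin> S"
  then show "z $ k = 0" using assms(1,2) assms(3)[of k] by (auto simp: pos_orthant_def)
qed

lemma mean_value_unordered:
  fixes g g' :: "real \<Rightarrow> real"
  assumes "\<And>t. \<lbrakk>min a b \<le> t; t \<le> max a b\<rbrakk> \<Longrightarrow> (g has_real_derivative g' t) (at t)"
  shows "\<exists>t. min a b \<le> t \<and> t \<le> max a b \<and> g b - g a = (b - a) * g' t"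
proof -
  consider "a < b" | "b < a" | "a = b" by linarith
  then show ?thesis
  proof cases
    case 1
    then obtain t where "a < t" "t < b" "g b - g a = (b - a) * g' t"
      using MVT2[of a b g g'] assms by auto
    then show ?thesis by (intro exI[of _ t]) auto
  next
    case 2
    then obtain t where "b < t" "t < a" "g a - g b = (a - b) * g' t"
      using MVT2[of b a g g'] assms by auto
    then show ?thesis by (intro exI[of _ t]) (auto simp: algebra_simps)
  qed auto
qed

lemma DERIV_along_coordinate:
  assumes "has_partial_deriv_at j f (\<chi> k. if k = j then t else y $ k)"
  shows "((\<lambda>u. f (\<chi> k. if k = j then u else y $ k)) has_real_derivative
           partial_deriv j f (\<chi> k. if k = j then t else y $ k)) (at t)"
proof -
  let ?z = "\<lambda>u. (\<chi> k. if k = j then u else y $ k)"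
  have shift: "?z t + u *\<^sub>R axis j 1 = ?z (u + t)" for u
    by (vector axis_def)
  have "((\<lambda>u. f (?z t + u *\<^sub>R axis j 1)) has_real_derivative partial_deriv j f (?z t)) (at 0)"
    using assms unfolding has_partial_deriv_at_def partial_deriv_def
    by (simp add: DERIV_deriv_iff_field_differentiable)
  then have "((\<lambda>u. f (?z (u + t))) has_real_derivative partial_deriv j f (?z t)) (at 0)"
    by (simp only: shift)
  then show ?thesis
    using DERIV_shift[of "\<lambda>u. f (?z u)" "partial_deriv j f (?z t)" 0 t] by simp
qed

text \<open>
  Changing the coordinates in \<open>A\<close> one after the other and applying the one-dimensional mean value
  theorem to each change needs only the partial derivatives, not total differentiability. The
  intermediate points depend on the coordinate, but all lie in the box spanned by \<open>x\<close> and \<open>y\<close>.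
\<close>

lemma coordinatewise_mean_value:
  fixes f :: "real ^ 'm::finite \<Rightarrow> real"
  assumes "A \<subseteq> S" "x \<in> pos_orthant S" "y \<in> pos_orthant S"
    and "\<And>k. k \<notin> A \<Longrightarrow> y $ k = x $ k"
    and "\<And>j z. \<lbrakk>j \<in> A; z \<in> pos_orthant S\<rbrakk> \<Longrightarrow> has_partial_deriv_at j f z"
  obtains \<xi> where
    "\<And>j k. j \<in> A \<Longrightarrow> min (x $ k) (y $ k) \<le> \<xi> j $ k \<and> \<xi> j $ k \<le> max (x $ k) (y $ k)"
    "f y - f x = (\<Sum>j\<in>A. (y $ j - x $ j) * partial_deriv j f (\<xi> j))"
proof -
  have "finite A" by simp
  then have "\<exists>\<xi>. (\<forall>j\<in>A. \<forall>k. min (x $ k) (y $ k) \<le> \<xi> j $ k \<and> \<xi> j $ k \<le> max (x $ k) (y $ k)) \<and>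
    f y - f x = (\<Sum>j\<in>A. (y $ j - x $ j) * partial_deriv j f (\<xi> j))"
    using assms
  proof (induction A arbitrary: y rule: finite_induct)
    case empty
    then have "y = x" by (simp add: vec_eq_iff)
    then show ?case by simp
  next
    case (insert a A)
    \<comment> \<open>The last leg of the walk from \<open>x\<close> to \<open>y\<close>: only coordinate \<open>a\<close> moves.\<close>
    define z where "z = (\<lambda>t. \<chi> k. if k = a then t else y $ k)"
    have z_nth: "z t $ k = (if k = a then t else y $ k)" for t k by (simp add: z_def)
    have zy: "z (y $ a) = y" by (simp add: vec_eq_iff z_nth)
    have z_pos: "z t \<in> pos_orthant S" if "min (x $ a) (y $ a) \<le> t" "t \<le> max (x $ a) (y $ a)" for t
      by (rule pos_orthant_between[OF insert.prems(2,3)]) (use that in \<open>auto simp: z_nth\<close>)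
    obtain \<xi> where \<xi>:
        "\<forall>j\<in>A. \<forall>k. min (x $ k) (z (x $ a) $ k) \<le> \<xi> j $ k \<and> \<xi> j $ k \<le> max (x $ k) (z (x $ a) $ k)"
        "f (z (x $ a)) - f x = (\<Sum>j\<in>A. (z (x $ a) $ j - x $ j) * partial_deriv j f (\<xi> j))"
    proof (atomize_elim, rule insert.IH)
      show "z (x $ a) \<in> pos_orthant S" by (rule z_pos) auto
      show "z (x $ a) $ k = x $ k" if "k \<notin> A" for k
        using insert.prems(4)[of k] that by (auto simp: z_nth)
    qed (use insert.prems in auto)
    have "((\<lambda>u. f (z u)) has_real_derivative partial_deriv a f (z t)) (at t)"
      if "min (x $ a) (y $ a) \<le> t" "t \<le> max (x $ a) (y $ a)" for t
      unfolding z_def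
      by (rule DERIV_along_coordinate, rule insert.prems(5)) (use z_pos[OF that] in \<open>auto simp: z_def\<close>)
    from mean_value_unordered[OF this] obtain t where t:
      "min (x $ a) (y $ a) \<le> t" "t \<le> max (x $ a) (y $ a)"
      "f (z (y $ a)) - f (z (x $ a)) = (y $ a - x $ a) * partial_deriv a f (z t)"
      by auto
    let ?\<xi> = "\<xi>(a := z t)"
    have "f y - f x = (y $ a - x $ a) * partial_deriv a f (z t)
        + (\<Sum>j\<in>A. (z (x $ a) $ j - x $ j) * partial_deriv j f (\<xi> j))"
      using t(3) \<xi>(2) zy by simp
    also have "(\<Sum>j\<in>A. (z (x $ a) $ j - x $ j) * partial_deriv j f (\<xi> j))
        = (\<Sum>j\<in>A. (y $ j - x $ j) * partial_deriv j f (?\<xi> j))"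
      using insert.hyps by (intro sum.cong) (auto simp: z_nth)
    finally have "f y - f x = (\<Sum>j\<in>insert a A. (y $ j - x $ j) * partial_deriv j f (?\<xi> j))"
      using insert.hyps by simp
    moreover have "min (x $ k) (y $ k) \<le> ?\<xi> j $ k \<and> ?\<xi> j $ k \<le> max (x $ k) (y $ k)"
      if j: "j \<in> insert a A" for j k
    proof (cases "j = a")
      case True
      then show ?thesis using t by (auto simp: z_nth)
    next
      case False
      then have "min (x $ k) (z (x $ a) $ k) \<le> \<xi> j $ k \<and> \<xi> j $ k \<le> max (x $ k) (z (x $ a) $ k)"
        using \<xi>(1) j by blast
      then show ?thesis using False by (auto simp: z_nth split: if_splits)
    qed
    ultimately show ?case by blast
  qed
  then show ?thesis using that by blast
qed

section \<open>First-order partial derivatives of a generating function\<close>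

lemma gev_partial_deriv:
  assumes "gev_cpgf_on S H" "j \<in> S"
  shows gev_has_partial: "Y \<in> pos_orthant S \<Longrightarrow> has_partial_deriv_at j H Y"
    and gev_partial_continuous: "continuous_on (pos_orthant S) (partial_deriv j H)"
    and gev_partial_pos: "Y \<in> pos_orthant S \<Longrightarrow> 0 < partial_deriv j H Y"
proof -
  have "(\<forall>Y\<in>pos_orthant S. has_partial_deriv_at j (mixed_partial [] H) Y) \<and>
        continuous_on (pos_orthant S) (mixed_partial [j] H)"
    using assms unfolding gev_cpgf_on_def has_continuous_mixed_partials_def
    by (elim conjE allE[of _ j] allE[of _ "[]"]) auto
  then show "Y \<in> pos_orthant S \<Longrightarrow> has_partial_deriv_at j H Y"
    "continuous_on (pos_orthant S) (partial_deriv j H)" by auto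
  have "\<forall>js. js \<noteq> [] \<and> distinct js \<and> set js \<subseteq> S \<longrightarrow>
        (\<forall>Y\<in>pos_orthant S. (odd (length js) \<longrightarrow> 0 < mixed_partial js H Y))"
    using assms(1) unfolding gev_cpgf_on_def by blast
  from this[rule_format, of "[j]" Y] show "Y \<in> pos_orthant S \<Longrightarrow> 0 < partial_deriv j H Y"
    using assms(2) by simp
qed

lemma gev_second_partial:
  assumes "gev_cpgf_on S H" "j \<in> S" "k \<in> S" "k \<noteq> j" "Y \<in> pos_orthant S"
  shows gev_has_second_partial: "has_partial_deriv_at k (partial_deriv j H) Y"
    and gev_second_partial_nonpos: "partial_deriv k (partial_deriv j H) Y \<le> 0"
proof -
  have "\<forall>Y\<in>pos_orthant S. has_partial_deriv_at k (mixed_partial [j] H) Y"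
    using assms unfolding gev_cpgf_on_def has_continuous_mixed_partials_def
    by (elim conjE allE[of _ k] allE[of _ "[j]"]) auto
  then show "has_partial_deriv_at k (partial_deriv j H) Y" using assms by auto
  have "\<forall>js. js \<noteq> [] \<and> distinct js \<and> set js \<subseteq> S \<longrightarrow>
        (\<forall>Y\<in>pos_orthant S. (even (length js) \<longrightarrow> mixed_partial js H Y \<le> 0))"
    using assms(1) unfolding gev_cpgf_on_def by blast
  from this[rule_format, of "[k, j]" Y] show "partial_deriv k (partial_deriv j H) Y \<le> 0"
    using assms(2-) by simp
qed

lemma pos_orthant_subset_orthant: "Y \<in> pos_orthant S \<Longrightarrow> Y \<in> orthant S"
  by (auto simp: pos_orthant_def orthant_def less_imp_le)

lemma pos_orthant_scaleR: "\<lbrakk>Y \<in> pos_orthant S; 0 < c\<rbrakk> \<Longrightarrow> c *\<^sub>R Y \<in> pos_orthant S"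
  by (auto simp: pos_orthant_def)

lemma gev_homogeneous:
  assumes "gev_cpgf_on S H" "Y \<in> orthant S" "0 < c"
  shows "H (c *\<^sub>R Y) = c * H Y"
  using assms by (simp add: gev_cpgf_on_def)

lemma gev_partial_scaleR:
  assumes gev: "gev_cpgf_on S H" and j: "j \<in> S" and Y: "Y \<in> pos_orthant S" and c: "0 < c"
  shows "partial_deriv j H (c *\<^sub>R Y) = partial_deriv j H Y"
proof -
  let ?e = "axis j (1::real)"
  have "((\<lambda>t. H (Y + t *\<^sub>R ?e)) has_real_derivative partial_deriv j H Y) (at (0 / c))"
    using gev_has_partial[OF gev j Y] unfolding has_partial_deriv_at_def partial_deriv_def
    by (simp add: DERIV_deriv_iff_field_differentiable)
  from DERIV_cmult[OF DERIV_chain2[OF this DERIV_cdivide[OF DERIV_ident]], of c]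
  have D: "((\<lambda>t. c * H (Y + (t / c) *\<^sub>R ?e)) has_real_derivative partial_deriv j H Y) (at 0)"
    using c by simp
  \<comment> \<open>Homogeneity is known only on the orthant, which the line leaves for very negative \<open>t\<close>.\<close>
  have "\<forall>\<^sub>F t in nhds (0::real). - (c * Y $ j) < t"
    using Y j c by (intro eventually_nhds_in_open[of "{- (c * Y $ j)<..}", simplified])
      (auto simp: pos_orthant_def)
  then have "\<forall>\<^sub>F t in nhds (0::real). c * H (Y + (t / c) *\<^sub>R ?e) = H (c *\<^sub>R Y + t *\<^sub>R ?e)"
  proof eventually_elim
    case (elim t)
    have "Y + (t / c) *\<^sub>R ?e \<in> orthant S"
      using Y j elim c by (auto simp: pos_orthant_def orthant_def axis_def field_simps less_imp_le)
    moreover have "c *\<^sub>R (Y + (t / c) *\<^sub>R ?e) = c *\<^sub>R Y + t *\<^sub>R ?e"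
      using c by (simp add: algebra_simps)
    ultimately show ?case using gev_homogeneous[OF gev _ c] by metis
  qed
  from DERIV_cong_ev[OF refl this refl, THEN iffD1, OF D] show ?thesis
    unfolding partial_deriv_def by (rule DERIV_imp_deriv)
qed

lemma gev_partial_antimono:
  assumes gev: "gev_cpgf_on S H" and j: "j \<in> S"
    and x: "x \<in> pos_orthant S" and y: "y \<in> pos_orthant S"
    and same: "x $ j = y $ j" and le: "\<And>k. k \<in> S \<Longrightarrow> x $ k \<le> y $ k"
  shows "partial_deriv j H y \<le> partial_deriv j H x"
proof -
  have "y $ k = x $ k" if "k \<notin> S - {j}" for k
    using that same x y by (auto simp: pos_orthant_def)
  then obtain \<xi> where \<xi>:
    "\<And>i k. i \<in> S - {j} \<Longrightarrow> min (x $ k) (y $ k) \<le> \<xi> i $ k \<and> \<xi> i $ k \<le> max (x $ k) (y $ k)"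
    "partial_deriv j H y - partial_deriv j H x
       = (\<Sum>i\<in>S - {j}. (y $ i - x $ i) * partial_deriv i (partial_deriv j H) (\<xi> i))"
    using coordinatewise_mean_value[of "S - {j}" S x y "partial_deriv j H"] x y
      gev_has_second_partial[OF gev j] by blast
  have "(y $ i - x $ i) * partial_deriv i (partial_deriv j H) (\<xi> i) \<le> 0" if i: "i \<in> S - {j}" for i
  proof -
    have "\<xi> i \<in> pos_orthant S" using pos_orthant_between[OF x y] \<xi>(1)[OF i] by blast
    then show ?thesis
      using gev_second_partial_nonpos[OF gev j, of i] i le[of i] by (auto intro!: mult_nonneg_nonpos)
  qed
  then show ?thesis using \<xi>(2) sum_nonpos[of "S - {j}"] by (metis (no_types, lifting) diff_le_0_iff_le)
qed

text \<open>
  This is the form in which homogeneity and the sign of the mixed derivatives enter all later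
  estimates: rescaling \<open>x\<close>, which leaves the partial derivative unchanged, makes the \<open>j\<close>-th
  coordinates agree and turns the comparison of ratios into a comparison of the other coordinates.
  The ratios are written as products to avoid division.
\<close>

lemma gev_partial_le_if_ratios_le:
  assumes gev: "gev_cpgf_on S H" and j: "j \<in> S"
    and x: "x \<in> pos_orthant S" and y: "y \<in> pos_orthant S"
    and ratios: "\<And>k. k \<in> S \<Longrightarrow> x $ k * y $ j \<le> y $ k * x $ j"
  shows "partial_deriv j H y \<le> partial_deriv j H x"
proof -
  have pos: "0 < x $ j" "0 < y $ j" using x y j by (auto simp: pos_orthant_def)
  define c where "c = y $ j / x $ j"
  have c: "0 < c" using pos by (simp add: c_def)
  have "partial_deriv j H y \<le> partial_deriv j H (c *\<^sub>R x)"
    by (rule gev_partial_antimono[OF gev j pos_orthant_scaleR[OF x c] y])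
      (use pos ratios in \<open>auto simp: c_def field_simps\<close>)
  then show ?thesis using gev_partial_scaleR[OF gev j x c] by simp
qed

lemma gev_strict_mono:
  assumes gev: "gev_cpgf_on S H"
    and x: "x \<in> pos_orthant S" and y: "y \<in> pos_orthant S"
    and le: "\<And>k. k \<in> S \<Longrightarrow> x $ k \<le> y $ k" and less: "j \<in> S" "x $ j < y $ j"
  shows "H x < H y"
proof -
  have "y $ k = x $ k" if "k \<notin> S" for k using that x y by (auto simp: pos_orthant_def)
  then obtain \<xi> where \<xi>:
    "\<And>i k. i \<in> S \<Longrightarrow> min (x $ k) (y $ k) \<le> \<xi> i $ k \<and> \<xi> i $ k \<le> max (x $ k) (y $ k)"
    "H y - H x = (\<Sum>i\<in>S. (y $ i - x $ i) * partial_deriv i H (\<xi> i))"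
    using coordinatewise_mean_value[of S S x y H] x y gev_has_partial[OF gev] by blast
  have "0 < partial_deriv i H (\<xi> i)" if "i \<in> S" for i
    using gev_partial_pos[OF gev that] pos_orthant_between[OF x y] \<xi>(1)[OF that] by blast
  then have "0 < (\<Sum>i\<in>S. (y $ i - x $ i) * partial_deriv i H (\<xi> i))"
    using le less by (intro sum_pos2[of S j]) (auto simp: less_imp_le)
  then show ?thesis using \<xi>(2) by simp
qed

section \<open>Convexity on the positive orthant\<close>

text \<open>
  Multiplying all ratios \<open>x\<^sub>k / x\<^sub>j\<close>, \<open>k \<noteq> j\<close>, by \<open>q\<close>: this gives explicit bounds for \<open>H\<^sub>j\<close> at the
  unknown intermediate points of the mean value theorem, and these tend to \<open>H\<^sub>j(x)\<close> as \<open>q \<rightarrow> 1\<close>.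
\<close>

definition scale_others :: "'m::finite \<Rightarrow> real \<Rightarrow> real ^ 'm \<Rightarrow> real ^ 'm" where
  "scale_others j q x = (\<chi> k. if k = j then x $ k else q * x $ k)"

lemma scale_others_pos: "\<lbrakk>x \<in> pos_orthant S; 0 < q\<rbrakk> \<Longrightarrow> scale_others j q x \<in> pos_orthant S"
  by (auto simp: pos_orthant_def scale_others_def)

lemma gev_partial_scale_others_tendsto:
  assumes gev: "gev_cpgf_on S H" and j: "j \<in> S" and x: "x \<in> pos_orthant S"
    and q: "(q \<longlongrightarrow> 1) F"
  shows "((\<lambda>e. partial_deriv j H (scale_others j (q e) x)) \<longlongrightarrow> partial_deriv j H x) F"
proof (rule continuous_on_tendsto_compose[OF gev_partial_continuous[OF gev j] _ x])
  have "((\<lambda>e. scale_others j (q e) x) \<longlongrightarrow> (\<chi> k. if k = j then x $ k else 1 * x $ k)) F"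
    unfolding scale_others_def by (rule vec_tendstoI) (auto intro!: tendsto_eq_intros q)
  moreover have "(\<chi> k. if k = j then x $ k else 1 * x $ k) = x" by (simp add: vec_eq_iff)
  ultimately show "((\<lambda>e. scale_others j (q e) x) \<longlongrightarrow> x) F" by simp
  have "\<forall>\<^sub>F e in F. 0 < q e" using q by (rule order_tendstoD) simp
  then show "\<forall>\<^sub>F e in F. scale_others j (q e) x \<in> pos_orthant S"
    by eventually_elim (rule scale_others_pos[OF x])
qed

text \<open>
  One half of Euler's relation, from \<open>e H(x) = H((1 + e) x) - H(x)\<close>. In the box between \<open>x\<close> and
  \<open>(1 + e) x\<close> all ratios of coordinates are within a factor \<open>1 + e\<close> of those of \<open>x\<close>. The other
  half is the case \<open>y = x\<close> of the tangent inequality.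
\<close>

lemma gev_Euler_le:
  assumes gev: "gev_cpgf_on S H" and x: "x \<in> pos_orthant S"
  shows "H x \<le> (\<Sum>j\<in>S. x $ j * partial_deriv j H x)"
proof -
  have bound: "H x \<le> (\<Sum>j\<in>S. x $ j * partial_deriv j H (scale_others j (1 / (1 + e)) x))"
    if e: "0 < e" for e :: real
  proof -
    let ?y = "(1 + e) *\<^sub>R x"
    have y: "?y \<in> pos_orthant S" using x e by (intro pos_orthant_scaleR) auto
    have nonneg: "0 \<le> x $ k" for k using x by (cases "k \<in> S") (auto simp: pos_orthant_def less_imp_le)
    have "?y $ k = x $ k" if "k \<notin> S" for k using that x by (auto simp: pos_orthant_def)
    then obtain \<xi> where \<xi>:
      "\<And>i k. i \<in> S \<Longrightarrow> min (x $ k) (?y $ k) \<le> \<xi> i $ k \<and> \<xi> i $ k \<le> max (x $ k) (?y $ k)"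
      "H ?y - H x = (\<Sum>i\<in>S. (?y $ i - x $ i) * partial_deriv i H (\<xi> i))"
      using coordinatewise_mean_value[of S S x ?y H] x y gev_has_partial[OF gev] by blast
    have le: "partial_deriv j H (\<xi> j) \<le> partial_deriv j H (scale_others j (1 / (1 + e)) x)"
      if j: "j \<in> S" for j
    proof (rule gev_partial_le_if_ratios_le[OF gev j])
      show "scale_others j (1 / (1 + e)) x \<in> pos_orthant S" using x e by (intro scale_others_pos) auto
      show "\<xi> j \<in> pos_orthant S" using pos_orthant_between[OF x y] \<xi>(1)[OF j] by blast
      have xi: "x $ k \<le> \<xi> j $ k" "\<xi> j $ k \<le> (1 + e) * x $ k" for k
        using \<xi>(1)[OF j, of k] nonneg[of k] e by (auto simp: min_def max_def algebra_simps split: if_splits)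
      show "scale_others j (1 / (1 + e)) x $ k * \<xi> j $ j
          \<le> \<xi> j $ k * scale_others j (1 / (1 + e)) x $ j" for k
      proof (cases "k = j")
        case False
        have "x $ k * \<xi> j $ j \<le> \<xi> j $ k * ((1 + e) * x $ j)"
          by (intro mult_mono xi nonneg order_trans[OF nonneg xi(1)])
        then show ?thesis using False e by (simp add: scale_others_def field_simps)
      qed simp
    qed
    have "e * H x = H ?y - H x"
      using gev_homogeneous[OF gev pos_orthant_subset_orthant[OF x], of "1 + e"] e
      by (simp add: algebra_simps)
    also have "\<dots> = e * (\<Sum>j\<in>S. x $ j * partial_deriv j H (\<xi> j))"
      unfolding \<xi>(2) by (simp add: sum_distrib_left algebra_simps)
    finally have "H x = (\<Sum>j\<in>S. x $ j * partial_deriv j H (\<xi> j))" using e by simp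
    also have "\<dots> \<le> (\<Sum>j\<in>S. x $ j * partial_deriv j H (scale_others j (1 / (1 + e)) x))"
      by (intro sum_mono mult_left_mono le nonneg)
    finally show ?thesis .
  qed
  have "((\<lambda>e. \<Sum>j\<in>S. x $ j * partial_deriv j H (scale_others j (1 / (1 + e)) x))
      \<longlongrightarrow> (\<Sum>j\<in>S. x $ j * partial_deriv j H x)) (at_right 0)"
    by (intro tendsto_sum tendsto_mult_left gev_partial_scale_others_tendsto[OF gev _ x])
      (auto intro!: tendsto_eq_intros)
  then show ?thesis
    by (rule tendsto_lowerbound)
      (auto simp: eventually_at_right_field intro!: exI[of _ 1] bound)
qed

definition truncated_ray :: "real ^ 'm::finite \<Rightarrow> real ^ 'm \<Rightarrow> real \<Rightarrow> real ^ 'm" where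
  "truncated_ray x y s = (\<chi> k. min (s * x $ k) (y $ k))"

lemma truncated_ray_nth: "truncated_ray x y s $ k = min (s * x $ k) (y $ k)"
  by (simp add: truncated_ray_def)

lemma truncated_ray_pos:
  "\<lbrakk>x \<in> pos_orthant S; y \<in> pos_orthant S; 0 < s\<rbrakk> \<Longrightarrow> truncated_ray x y s \<in> pos_orthant S"
  by (auto simp: pos_orthant_def truncated_ray_nth)

text \<open>
  Between the times \<open>s\<close> and \<open>q * s\<close> a moving coordinate \<open>j\<close> is at least \<open>s * x\<^sub>j\<close>, and every
  coordinate \<open>k\<close> is at most \<open>q * s * x\<^sub>k\<close>, so the ratios to the \<open>j\<close>-th coordinate exceed those of
  \<open>x\<close> by a factor of at most \<open>q\<close>. This bound does not depend on \<open>s\<close>, which is why steps in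
  geometric progression can be added up.
\<close>

lemma gev_truncated_ray_step:
  assumes gev: "gev_cpgf_on S H" and x: "x \<in> pos_orthant S" and y: "y \<in> pos_orthant S"
    and q: "1 < q" and s: "0 < s"
  shows "(\<Sum>j\<in>S. (truncated_ray x y (q * s) $ j - truncated_ray x y s $ j)
            * partial_deriv j H (scale_others j q x))
         \<le> H (truncated_ray x y (q * s)) - H (truncated_ray x y s)"
proof -
  let ?a = "truncated_ray x y s" and ?b = "truncated_ray x y (q * s)"
  have a: "?a \<in> pos_orthant S" and b: "?b \<in> pos_orthant S"
    using x y q s by (auto intro!: truncated_ray_pos)
  have nonneg: "0 \<le> x $ k" for k using x by (cases "k \<in> S") (auto simp: pos_orthant_def less_imp_le)
  have sx: "s * x $ k \<le> q * s * x $ k" for k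
    using nonneg[of k] q s by (simp add: mult_right_mono)
  then have ab: "?a $ k \<le> ?b $ k" for k
    unfolding truncated_ray_nth by (rule min.mono) simp
  have "?b $ k = ?a $ k" if "k \<notin> S" for k using that a b by (auto simp: pos_orthant_def)
  then obtain \<xi> where \<xi>:
    "\<And>i k. i \<in> S \<Longrightarrow> min (?a $ k) (?b $ k) \<le> \<xi> i $ k \<and> \<xi> i $ k \<le> max (?a $ k) (?b $ k)"
    "H ?b - H ?a = (\<Sum>i\<in>S. (?b $ i - ?a $ i) * partial_deriv i H (\<xi> i))"
    using coordinatewise_mean_value[of S S ?a ?b H] a b gev_has_partial[OF gev] by blast
  have "(?b $ j - ?a $ j) * partial_deriv j H (scale_others j q x)
      \<le> (?b $ j - ?a $ j) * partial_deriv j H (\<xi> j)" if j: "j \<in> S" for j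
  proof (cases "?b $ j = ?a $ j")
    case False
    then have aj: "?a $ j = s * x $ j" using sx[of j] by (auto simp: truncated_ray_nth min_def split: if_splits)
    have \<xi>_le: "\<xi> j $ k \<le> q * s * x $ k" for k
      using \<xi>(1)[OF j, of k] ab[of k] by (auto simp: truncated_ray_nth)
    have \<xi>_ge: "s * x $ j \<le> \<xi> j $ j"
      using \<xi>(1)[OF j, of j] ab[of j] aj by auto
    have "partial_deriv j H (scale_others j q x) \<le> partial_deriv j H (\<xi> j)"
    proof (rule gev_partial_le_if_ratios_le[OF gev j])
      show "\<xi> j \<in> pos_orthant S" using pos_orthant_between[OF a b] \<xi>(1)[OF j] by blast
      show "scale_others j q x \<in> pos_orthant S" using x q by (intro scale_others_pos) auto
      show "\<xi> j $ k * scale_others j q x $ j \<le> scale_others j q x $ k * \<xi> j $ j" for k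
      proof (cases "k = j")
        case False
        have "\<xi> j $ k * x $ j \<le> q * s * x $ k * x $ j"
          by (intro mult_right_mono \<xi>_le nonneg)
        also have "\<dots> = q * x $ k * (s * x $ j)" by simp
        also have "\<dots> \<le> q * x $ k * \<xi> j $ j"
          using q by (intro mult_left_mono \<xi>_ge mult_nonneg_nonneg nonneg) auto
        finally show ?thesis using False by (simp add: scale_others_def)
      qed (simp add: scale_others_def)
    qed
    then show ?thesis using ab[of j] by (intro mult_left_mono) auto
  qed simp
  then show ?thesis unfolding \<xi>(2) by (rule sum_mono)
qed

lemma gev_truncated_ray_steps:
  assumes "gev_cpgf_on S H" "x \<in> pos_orthant S" "y \<in> pos_orthant S" "1 < q" "0 < s"
  shows "(\<Sum>j\<in>S. (truncated_ray x y (q ^ n * s) $ j - truncated_ray x y s $ j)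
            * partial_deriv j H (scale_others j q x))
         \<le> H (truncated_ray x y (q ^ n * s)) - H (truncated_ray x y s)"
proof (induction n)
  case (Suc n)
  have "0 < q ^ n * s" using assms by simp
  from gev_truncated_ray_step[OF assms(1-4) this] Suc
  show ?case by (simp add: algebra_simps sum.distrib sum_subtractf)
qed simp

text \<open>
  The parameter \<open>e\<close> serves both as the starting time, where the bound \<open>H \<ge> 0\<close> is used, and as
  the relative step length, so that a single limit \<open>e \<rightarrow> 0\<close> removes both errors.
\<close>

lemma gev_tangent_le:
  assumes gev: "gev_cpgf_on S H" and x: "x \<in> pos_orthant S" and y: "y \<in> pos_orthant S"
  shows "(\<Sum>j\<in>S. y $ j * partial_deriv j H x) \<le> H y"
proof -
  have bound: "(\<Sum>j\<in>S. (y $ j - e * x $ j) * partial_deriv j H (scale_others j (1 + e) x)) \<le> H y"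
    if e: "0 < e" for e :: real
  proof -
    \<comment> \<open>The sum bounds each quotient; once the time exceeds them all, the path has reached \<open>y\<close>.\<close>
    obtain n where n: "(\<Sum>j\<in>S. y $ j / (e * x $ j)) < (1 + e) ^ n"
      using real_arch_pow[of "1 + e"] e by auto
    have "y $ j \<le> (1 + e) ^ n * e * x $ j" for j
    proof (cases "j \<in> S")
      case True
      then have "y $ j / (e * x $ j) \<le> (\<Sum>j\<in>S. y $ j / (e * x $ j))"
        using x y e by (intro member_le_sum) (auto simp: pos_orthant_def less_imp_le)
      then have "y $ j / (e * x $ j) \<le> (1 + e) ^ n" using n by simp
      moreover have "0 < e * x $ j" using True x e by (simp add: pos_orthant_def)
      ultimately show ?thesis by (simp add: pos_divide_le_eq mult.assoc)
    qed (use x y in \<open>auto simp: pos_orthant_def\<close>)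
    then have end_y: "truncated_ray x y ((1 + e) ^ n * e) = y"
      by (simp add: vec_eq_iff truncated_ray_nth min_absorb2)
    have "0 \<le> H (truncated_ray x y e)"
      using gev truncated_ray_pos[OF x y e] pos_orthant_subset_orthant unfolding gev_cpgf_on_def by blast
    moreover have "(\<Sum>j\<in>S. (y $ j - e * x $ j) * partial_deriv j H (scale_others j (1 + e) x))
      \<le> (\<Sum>j\<in>S. (y $ j - truncated_ray x y e $ j) * partial_deriv j H (scale_others j (1 + e) x))"
      using gev_partial_pos[OF gev _ scale_others_pos[OF x]] e
      by (intro sum_mono mult_right_mono) (auto simp: truncated_ray_nth less_imp_le)
    ultimately show ?thesis
      using gev_truncated_ray_steps[OF gev x y, of "1 + e" e n] e unfolding end_y by simp
  qed
  have "((\<lambda>e. \<Sum>j\<in>S. (y $ j - e * x $ j) * partial_deriv j H (scale_others j (1 + e) x))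
      \<longlongrightarrow> (\<Sum>j\<in>S. (y $ j - 0 * x $ j) * partial_deriv j H x)) (at_right 0)"
    by (intro tendsto_sum tendsto_mult gev_partial_scale_others_tendsto[OF gev _ x])
      (auto intro!: tendsto_eq_intros)
  then have "(\<Sum>j\<in>S. (y $ j - 0 * x $ j) * partial_deriv j H x) \<le> H y"
    by (rule tendsto_upperbound)
      (auto simp: eventually_at_right_field intro!: exI[of _ 1] bound)
  then show ?thesis by simp
qed

text \<open>
  The tangent inequalities at \<open>p = (1 - t) x + t y\<close> for \<open>x\<close> and for \<open>y\<close> add up to
  \<open>\<Sum> p\<^sub>j H\<^sub>j(p)\<close>, which Euler's relation bounds below by \<open>H(p)\<close>.
\<close>

lemma gev_convex:
  assumes gev: "gev_cpgf_on S H" and x: "x \<in> pos_orthant S" and y: "y \<in> pos_orthant S"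
    and t: "0 < t" "t < 1"
  shows "H ((1 - t) *\<^sub>R x + t *\<^sub>R y) \<le> (1 - t) * H x + t * H y"
proof -
  let ?p = "(1 - t) *\<^sub>R x + t *\<^sub>R y"
  have p: "?p \<in> pos_orthant S" using x y t by (auto simp: pos_orthant_def intro!: add_pos_pos)
  have "H ?p \<le> (\<Sum>j\<in>S. ?p $ j * partial_deriv j H ?p)" by (rule gev_Euler_le[OF gev p])
  also have "\<dots> = (1 - t) * (\<Sum>j\<in>S. x $ j * partial_deriv j H ?p)
      + t * (\<Sum>j\<in>S. y $ j * partial_deriv j H ?p)"
    by (simp add: sum_distrib_left sum.distrib[symmetric] algebra_simps)
  also have "\<dots> \<le> (1 - t) * H x + t * H y"
    using t by (intro add_mono mult_left_mono gev_tangent_le[OF gev p] x y) auto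
  finally show ?thesis .
qed

section \<open>Strict convexity in logarithmic coordinates\<close>

lemma exp_strictly_convex:
  fixes a b t :: real
  assumes "a \<noteq> b" "0 < t" "t < 1"
  shows "exp ((1 - t) * a + t * b) < (1 - t) * exp a + t * exp b"
proof -
  let ?m = "(1 - t) * a + t * b"
  have above_tangent: "1 + x < exp x" if "x \<noteq> 0" for x :: real
  proof -
    have "exp x \<noteq> 1 + x"
    proof
      assume "exp x = 1 + x"
      then have "ln (exp x) = exp x - 1" unfolding ln_exp by simp
      then show False using ln_eq_minus_one[of "exp x"] that by simp
    qed
    then show ?thesis using exp_ge_add_one_self[of x] by linarith
  qed
  have tangent: "exp ?m * (1 + (c - ?m)) < exp c" if "c \<noteq> ?m" for c
  proof -
    have "exp ?m * (1 + (c - ?m)) < exp ?m * exp (c - ?m)"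
      using above_tangent[of "c - ?m"] that by simp
    then show ?thesis by (simp add: exp_diff)
  qed
  have "a - ?m = t * (a - b)" "b - ?m = (1 - t) * (b - a)" by (simp_all add: algebra_simps)
  then have "a \<noteq> ?m" "b \<noteq> ?m" using assms by auto
  then have "(1 - t) * (exp ?m * (1 + (a - ?m))) + t * (exp ?m * (1 + (b - ?m)))
      < (1 - t) * exp a + t * exp b"
    using assms by (intro add_strict_mono mult_strict_left_mono tangent) auto
  then show ?thesis by (simp add: algebra_simps)
qed

theorem proposition3:
  fixes I :: "'i set" and G :: "'i \<Rightarrow> real ^ 'm::finite \<Rightarrow> real"
    and i :: 'i and S :: "'m set"
  assumes "finite I"
    and "\<forall>i\<in>I. gev_cpgf (G i)"
    and "\<forall>i\<in>I. \<forall>S. gev_cpgf_on S (restricted (G i) S)"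
    and "i \<in> I"
  shows "strictly_convex_in S (\<lambda>v. restricted (G i) S (exp_vec v))"
  unfolding strictly_convex_in_def
proof (intro allI impI, elim conjE bexE)
  fix v w :: "real ^ 'm" and t :: real and j
  assume t: "0 < t" "t < 1" and j: "j \<in> S" "v $ j \<noteq> w $ j"
  define H where "H = restricted (G i) S"
  \<comment> \<open>\<open>exp_vec u\<close> has positive entries outside \<open>S\<close>; these are cleared to land in the orthant of \<open>S\<close>.\<close>
  define P where "P = (\<lambda>u :: real ^ 'm. \<chi> k. if k \<in> S then exp (u $ k) else 0)"
  have gev: "gev_cpgf_on S H" using assms(3,4) by (simp add: H_def)
  have H_exp: "restricted (G i) S (exp_vec u) = H (P u)" for u
    unfolding H_def P_def restricted_def exp_vec_def
    by (rule arg_cong[where f = "G i"]) (simp add: vec_eq_iff)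
  have P: "P u \<in> pos_orthant S" for u by (simp add: P_def pos_orthant_def)
  let ?m = "(1 - t) *\<^sub>R v + t *\<^sub>R w" and ?p = "(1 - t) *\<^sub>R P v + t *\<^sub>R P w"
  have "H (P ?m) < H ?p"
  proof (rule gev_strict_mono[OF gev P _ _ j(1)])
    show "?p \<in> pos_orthant S"
      using P[of v] P[of w] t by (auto simp: pos_orthant_def intro!: add_pos_pos)
    show "P ?m $ k \<le> ?p $ k" if "k \<in> S" for k
      using that exp_strictly_convex[of "v $ k" "w $ k" t] t
      by (cases "v $ k = w $ k") (auto simp: P_def algebra_simps)
    show "P ?m $ j < ?p $ j"
      using j exp_strictly_convex[OF j(2) t] by (simp add: P_def)
  qed
  also have "\<dots> \<le> (1 - t) * H (P v) + t * H (P w)" by (rule gev_convex[OF gev P P t])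
  finally show "restricted (G i) S (exp_vec ?m)
      < (1 - t) * restricted (G i) S (exp_vec v) + t * restricted (G i) S (exp_vec w)"
    by (simp only: H_exp)
qed

end
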